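(* Let $\mathcal{G}=(\mathcal{V},\mathcal{E})$, $\mathcal{V}=\{1,\dots,N\}$, be an undirected connected graph, and for each $i\in\mathcal{V}$ let $B_{i,\mathrm D}(z)=z^{m_i}+\sum_{\ell=0}^{m_i-1}p_{i,\ell}z^\ell$ be the denominator of agent $i$'s local internal model. The distributed root-union algorithm described in the context, run for $K\in\mathbb{N}$ rounds, succeeds in computing the common denominator of $B_{i,\mathrm D}(z)$, $i\in\mathcal{V}$, provided that $K$ is larger than the diameter of the graph (that is, the length of the longest path between any two nodes in the graph).
   Context: Each agent $i\in\mathcal{V}$ has access to a local internal model, i.e. a rational $\mathcal{Z}$-transform $\mathcal{Z}[b_{i,k}]=B_{i,\mathrm N}(z)/B_{i,\mathrm D}(z)$ of its local sequence $\{b_{i,k}\}_{k\in\mathbb{N}}\subset\mathbb{R}^n$, with $m_i$ the degree of $B_{i,\mathrm D}$. The common denominator $B_{\mathrm D}(z)$ is a common denominator of all the agents' local transfer functions; the algorithm computes it by having the agents distributedly compute the union of the roots of $B_{i,\mathrm D}(z)$, $i\in\mathcal{V}$. $\mathcal{N}_i$ denotes the set of neighbors of $i$ in $\mathcal{G}$. Distributed root-union algorithm. Input: the local polynomials $B_{i,\mathrm D}(z)$, $i\in\mathcal{V}$, and a stopping condition $K\in\mathbb{N}$. Initialization: each agent $i$ computes the $m_i$ roots $\mathcal{R}_i$ of $B_{i,\mathrm D}(z)$. Then, for $k=1,2,\dots,K$, each agent $i$ sends $\mathcal{R}_i$ to each $j\in\mathcal{N}_i$, receives $\mathcal{R}_j$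 from each $j\in\mathcal{N}_i$, and updates $\mathcal{R}_i=\bigcup_{j\in\mathcal{N}_i\cup\{i\}}\mathcal{R}_j$. *)

theory Defs
  imports "HOL-Analysis.Analysis" "HOL-Computational_Algebra.Polynomial_Factorial"
    "HOL-Computational_Algebra.Field_as_Ring"
    "Graph_Theory.Graph_Theory"
begin

definition (in wf_digraph) diameter :: ereal where
  "diameter = (SUP u\<in>verts G. SUP v\<in>verts G. \<mu> (\<lambda>_. 1) u v)"

definition neighbors :: "'v pair_pre_digraph \<Rightarrow> 'v \<Rightarrow> 'v set" where
  "neighbors G i = {j. (i, j) \<in> parcs G}"

text \<open>
  The \<open>\<Z>\<close>-transform of \<open>b\<close> is the series of \<open>b k / z ^ k\<close> over \<open>k \<ge> 0\<close>, taken componentwise and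
  required to equal \<open>N / D\<close> wherever \<open>\<bar>z\<bar>\<close> is sufficiently large.
\<close>

definition has_rational_ztransform ::
    "(nat \<Rightarrow> real ^ 'n) \<Rightarrow> real poly ^ 'n \<Rightarrow> real poly \<Rightarrow> bool" where
  "has_rational_ztransform b N D \<longleftrightarrow>
     (\<forall>c. \<forall>\<^sub>F z in at_infinity.
        (\<lambda>k. complex_of_real (b k $ c) / z ^ k) sums
          (poly (map_poly of_real (N $ c)) z / poly (map_poly of_real D) z))"

text \<open>
  \<open>agent_roots G B k i\<close> is the collection \<open>\<R>\<^sub>i\<close> held by agent \<open>i\<close> after \<open>k\<close> rounds. Roots are
  counted with multiplicity, so \<open>\<R>\<^sub>i\<close> is a multiset and the union is the multiset union, in which
  each root has the maximum of its multiplicities; for a finite neighborhood this is the supremum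
  of the multisets with respect to \<open>\<subseteq>#\<close>.
\<close>

primrec agent_roots ::
    "'v pair_pre_digraph \<Rightarrow> ('v \<Rightarrow> real poly) \<Rightarrow> nat \<Rightarrow> 'v \<Rightarrow> complex multiset" where
  "agent_roots G B 0 i = proots (map_poly of_real (B i))"
| "agent_roots G B (Suc k) i = (SUP j\<in>neighbors G i \<union> {i}. agent_roots G B k j)"

definition agent_denominator ::
    "'v pair_pre_digraph \<Rightarrow> ('v \<Rightarrow> real poly) \<Rightarrow> nat \<Rightarrow> 'v \<Rightarrow> complex poly" where
  "agent_denominator G B K i = (\<Prod>r\<in>#agent_roots G B K i. [:- r, 1:])"

end

theory Submission
  imports Defs "HOL-Computational_Algebra.Fundamental_Theorem_Algebra"
begin

text \<open>
  After \<open>k\<close> rounds agent \<open>i\<close> holds the union of the root multisets of all agents within distance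
  \<open>k\<close>, hence after \<open>K\<close> rounds the union over all agents, so the monic polynomial with these
  roots is the complex least common multiple. It agrees with the real one because a real
  polynomial divides a complex polynomial exactly when it divides its real and imaginary parts.
\<close>

text \<open>Multiplication by a real polynomial acts separately on the real and imaginary parts of
  the coefficients, so a complex cofactor amounts to a pair of real cofactors.\<close>

lemma map_poly_of_real_dvd_iff:
  fixes p :: "real poly" and q :: "complex poly"
  shows "map_poly of_real p dvd q \<longleftrightarrow> p dvd map_poly Re q \<and> p dvd map_poly Im q"
proof
  assume "map_poly of_real p dvd q"
  then obtain r where q: "q = map_poly of_real p * r"
    by (elim dvdE)
  have "map_poly Re q = p * map_poly Re r" "map_poly Im q = p * map_poly Im r"
    by (auto simp: q poly_eq_iff coeff_map_poly coeff_mult)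
  then show "p dvd map_poly Re q \<and> p dvd map_poly Im q"
    by simp
next
  assume "p dvd map_poly Re q \<and> p dvd map_poly Im q"
  then obtain r s where *: "map_poly Re q = p * r" "map_poly Im q = p * s"
    by (auto elim!: dvdE)
  have mult: "map_poly complex_of_real (f * g) = map_poly of_real f * map_poly of_real g" for f g
    by (simp add: poly_eq_iff coeff_map_poly coeff_mult)
  have "q = map_poly of_real (map_poly Re q) + smult \<i> (map_poly of_real (map_poly Im q))"
    by (simp add: poly_eq_iff coeff_map_poly complex_eq)
  also have "\<dots> = map_poly of_real p * (map_poly of_real r + smult \<i> (map_poly of_real s))"
    by (simp add: * mult algebra_simps)
  finally show "map_poly of_real p dvd q"
    by simp
qed

text \<open>The criterion by real and imaginary parts reduces this to real polynomials, where
  \<open>Lcm_dvd_iff\<close> applies. Thus the real lcm keeps its universal property over the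
  complex numbers.\<close>

lemma map_poly_of_real_Lcm_dvd_iff:
  fixes A :: "real poly set" and q :: "complex poly"
  shows "map_poly of_real (Lcm A) dvd q \<longleftrightarrow> (\<forall>p\<in>A. map_poly of_real p dvd q)"
  by (auto simp: map_poly_of_real_dvd_iff Lcm_dvd_iff)

lemma proots_mono:
  fixes p q :: "'a :: idom poly"
  assumes "q \<noteq> 0" "p dvd q"
  shows "proots p \<subseteq># proots q"
proof -
  have "p \<noteq> 0"
    using assms by auto
  then show ?thesis
    using assms by (intro mset_subset_eqI) (simp add: dvd_imp_order_le)
qed

lemma proots_prod_linear_factors:
  fixes M :: "'a :: idom multiset"
  shows "proots (\<Prod>r\<in>#M. [:- r, 1:]) = M"
proof (induction M)
  case (add x M)
  have "(\<Prod>r\<in>#M. [:- r, 1:]) \<noteq> 0"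
    by (auto simp: prod_mset_zero_iff)
  then show ?case
    \<comment> \<open>\<open>mult_pCons_left\<close> would expand the product with
      \<open>[:- x, 1:]\<close> and destroy the form that \<open>proots_mult\<close>
      matches.\<close>
    using add by (simp add: proots_mult del: mult_pCons_left)
qed simp

lemma lead_coeff_prod_linear_factors:
  fixes M :: "'a :: idom multiset"
  shows "lead_coeff (\<Prod>r\<in>#M. [:- r, 1:]) = 1"
  by (induction M) (simp_all add: lead_coeff_mult del: mult_pCons_left)

text \<open>Up to its nonzero leading coefficient, \<open>p\<close> is the product of the linear
  factors of its own roots, so divisibility becomes inclusion of root multisets.\<close>

lemma dvd_prod_linear_factors_iff:
  fixes p :: "complex poly"
  assumes "p \<noteq> 0"
  shows "p dvd (\<Prod>r\<in>#M. [:- r, 1:]) \<longleftrightarrow> proots p \<subseteq># M"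
proof -
  have split: "p dvd (\<Prod>r\<in>#proots p. [:- r, 1:])"
    using complex_poly_decompose_multiset[of p] assms
    by (metis dvd_refl leading_coeff_0_iff smult_dvd_iff)
  show ?thesis
  proof
    assume "p dvd (\<Prod>r\<in>#M. [:- r, 1:])"
    then show "proots p \<subseteq># M"
      using proots_mono[of "\<Prod>r\<in>#M. [:- r, 1:]" p] lead_coeff_prod_linear_factors[of M]
      by (metis leading_coeff_0_iff proots_prod_linear_factors zero_neq_one)
  next
    assume "proots p \<subseteq># M"
    then show "p dvd (\<Prod>r\<in>#M. [:- r, 1:])"
      by (intro dvd_trans[OF split] prod_mset_subset_imp_dvd image_mset_subseteq_mono)
  qed
qed

text \<open>The dual translation, with the product as divisor: it bounds an agent's polynomial from
  above.\<close>

lemma prod_linear_factors_dvd_iff: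
  fixes p :: "complex poly"
  assumes "p \<noteq> 0"
  shows "(\<Prod>r\<in>#M. [:- r, 1:]) dvd p \<longleftrightarrow> M \<subseteq># proots p"
proof
  show "(\<Prod>r\<in>#M. [:- r, 1:]) dvd p \<Longrightarrow> M \<subseteq># proots p"
    using proots_mono[OF assms] by (metis proots_prod_linear_factors)
next
  assume "M \<subseteq># proots p"
  then have "(\<Prod>r\<in>#M. [:- r, 1:]) dvd (\<Prod>r\<in>#proots p. [:- r, 1:])"
    by (intro prod_mset_subset_imp_dvd image_mset_subseteq_mono)
  then show "(\<Prod>r\<in>#M. [:- r, 1:]) dvd p"
    using complex_poly_decompose_multiset[of p] by (metis dvd_smult)
qed

context pair_fin_digraph
begin

lemma finite_neighbors: "finite (neighbors G i)"
  unfolding neighbors_def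
  by (rule finite_subset[OF _ pair_finite_verts]) (auto dest: in_arcsD2)

lemma agent_roots_Suc_upper:
  assumes "j \<in> neighbors G i \<union> {i}"
  shows "agent_roots G B k j \<subseteq># agent_roots G B (Suc k) i"
  unfolding agent_roots.simps
  \<comment> \<open>Multisets are only conditionally complete under \<open>\<subseteq>#\<close>;
    finiteness of the neighborhood supplies the bound.\<close>
  by (rule subset_mset.cSup_upper)
    (use assms finite_neighbors in \<open>auto intro!: subset_mset.bdd_above_finite\<close>)

text \<open>Neighbors are again vertices and a round only takes suprema, so a common bound
  \<open>M\<close> of the initial multisets persists.\<close>

lemma agent_roots_least:
  assumes "i \<in> pverts G"
    and "\<And>j. j \<in> pverts G \<Longrightarrow> proots (map_poly of_real (B j)) \<subseteq># M"
  shows "agent_roots G B k i \<subseteq># M"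
  using assms(1)
proof (induction k arbitrary: i)
  case (Suc k)
  then show ?case
    unfolding agent_roots.simps
    \<comment> \<open>\<open>cSup_least\<close> asks for a nonempty index set, which
      \<open>{i}\<close> guarantees.\<close>
    by (intro subset_mset.cSup_least) (auto simp: neighbors_def dest: in_arcsD2)
qed (use assms(2) in auto)

text \<open>The roots of \<open>j\<close> travel backwards along the walk, one arc per round. The
  first arc leads from \<open>i\<close> to a neighbor that has them one round earlier; on the empty
  walk \<open>i\<close> just keeps its own.\<close>

lemma agent_roots_upper:
  assumes "awalk i q j" "length q \<le> k"
  shows "proots (map_poly of_real (B j)) \<subseteq># agent_roots G B k i"
  using assms
proof (induction k arbitrary: i q)
  case (Suc k)
  show ?case
  proof (cases q)
    case Nil
    then have "proots (map_poly of_real (B j)) \<subseteq># agent_roots G B k i"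
      using Suc by (intro Suc.IH[of i "[]"]) auto
    then show ?thesis
      using agent_roots_Suc_upper[of i i B k] by auto
  next
    case (Cons e q')
    then have "awalk (snd e) q' j" and e: "snd e \<in> neighbors G i"
      using Suc.prems by (auto simp: awalk_Cons_iff neighbors_def)
    then have "proots (map_poly of_real (B j)) \<subseteq># agent_roots G B k (snd e)"
      using Suc.prems Cons by (intro Suc.IH) auto
    then show ?thesis
      using agent_roots_Suc_upper[of "snd e" i B k] e by auto
  qed
qed (auto simp: awalk_def)

end

text \<open>\<open>\<mu>\<close> is an infimum of walk costs, so a strict bound on it is witnessed
  by an actual walk, whose unit cost is its length.\<close>

lemma (in wf_digraph) short_awalk_of_diameter_less:
  assumes "diameter < ereal (real K)" "u \<in> verts G" "v \<in> verts G"
  obtains q where "awalk u q v" "length q < K"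
proof -
  have "\<mu> (\<lambda>_. 1) u v \<le> diameter"
    unfolding diameter_def by (intro SUP_upper2[OF assms(2)] SUP_upper[OF assms(3)])
  then have "\<mu> (\<lambda>_. 1) u v < ereal (real K)"
    using assms(1) by simp
  then obtain q where q: "awalk u q v" "ereal (awalk_cost (\<lambda>_. 1) q) < ereal (real K)"
    unfolding \<mu>_def INF_less_iff by auto
  moreover have "awalk_cost (\<lambda>_. 1) q = real (length q)"
    by (induction q) auto
  ultimately show ?thesis
    using that by simp
qed

lemma lead_coeff_monic_poly:
  fixes c :: "nat \<Rightarrow> 'a :: comm_semiring_1"
  shows "lead_coeff (monom 1 n + (\<Sum>l<n. monom (c l) l)) = 1"
proof -
  have coeff: "coeff (monom 1 n + (\<Sum>l<n. monom (c l) l)) k =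
      (if k = n then 1 else if k < n then c k else 0)" for k
    by (auto simp: coeff_sum)
  then have "degree (monom 1 n + (\<Sum>l<n. monom (c l) l)) = n"
    by (intro antisym degree_le le_degree) (simp_all only: coeff, auto)
  then show ?thesis
    by (simp only: coeff) simp
qed

lemma normalize_monic:
  fixes p :: "complex poly"
  shows "lead_coeff p = 1 \<Longrightarrow> normalize p = p"
  by (simp add: normalize_poly_eq_map_poly)

lemma lead_coeff_Lcm:
  fixes A :: "real poly set"
  assumes "finite A" "0 \<notin> A"
  shows "lead_coeff (Lcm A) = 1"
proof -
  have "Lcm A \<noteq> 0"
    using assms by (simp add: Lcm_0_iff)
  \<comment> \<open>An \<open>Lcm\<close> is its own normalization, and over a field normalizing a
    nonzero polynomial makes it monic.\<close>
  then have "lead_coeff (normalize (Lcm A)) = 1"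
    by (simp add: normalize_poly_eq_map_poly degree_map_poly coeff_map_poly)
  then show ?thesis
    by simp
qed

theorem lemma1:
  fixes G :: "nat pair_pre_digraph"
    and N K :: nat
    and b :: "nat \<Rightarrow> nat \<Rightarrow> real ^ 'n"
    and B\<^sub>N :: "nat \<Rightarrow> real poly ^ 'n"
    and B\<^sub>D :: "nat \<Rightarrow> real poly"
    and m :: "nat \<Rightarrow> nat"
    and p :: "nat \<Rightarrow> nat \<Rightarrow> real"
  assumes "pair_pseudo_graph G"
    and "pverts G = {1..N}"
    and "Digraph_Component.connected (with_proj G)"
    and "\<And>i. i \<in> {1..N} \<Longrightarrow> has_rational_ztransform (b i) (B\<^sub>N i) (B\<^sub>D i)"
    and "\<And>i. i \<in> {1..N} \<Longrightarrow> B\<^sub>D i = monom 1 (m i) + (\<Sum>l<m i. monom (p i l) l)"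
    and "ereal (real K) > wf_digraph.diameter (with_proj G)"
  shows "\<forall>i\<in>{1..N}. agent_denominator G B\<^sub>D K i = map_poly of_real (LCM j\<in>{1..N}. B\<^sub>D j)"
proof
  interpret pair_pseudo_graph G
    by fact
  fix i assume i: "i \<in> {1..N}"
  define L where "L = (LCM j\<in>{1..N}. B\<^sub>D j)"
  let ?c = "map_poly complex_of_real"
  have nz: "B\<^sub>D j \<noteq> 0" if "j \<in> {1..N}" for j
    using lead_coeff_monic_poly[of "m j" "p j"] assms(5)[OF that] by (metis leading_coeff_0_iff zero_neq_one)
  have L: "lead_coeff L = 1"
    unfolding L_def by (rule lead_coeff_Lcm) (use nz in force)+
  then have "L \<noteq> 0"
    by auto
  then have "?c L \<noteq> 0"
    by (simp add: map_poly_eq_0_iff)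
  have "?c (B\<^sub>D j) dvd ?c L" if "j \<in> {1..N}" for j
    using that map_poly_of_real_Lcm_dvd_iff[of "B\<^sub>D ` {1..N}" "?c L"] by (simp add: L_def)
  then have "agent_roots G B\<^sub>D K i \<subseteq># proots (?c L)"
    using i assms(2) \<open>?c L \<noteq> 0\<close> by (intro agent_roots_least proots_mono) auto
  then have le: "agent_denominator G B\<^sub>D K i dvd ?c L"
    unfolding agent_denominator_def by (simp add: prod_linear_factors_dvd_iff \<open>?c L \<noteq> 0\<close>)
  \<comment> \<open>This is where \<open>K\<close> enters: every agent \<open>j\<close> is within
    reach of \<open>i\<close> in \<open>K\<close> rounds.\<close>
  have "?c (B\<^sub>D j) dvd agent_denominator G B\<^sub>D K i" if j: "j \<in> {1..N}" for j
  proof -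
    obtain q where "awalk i q j" "length q < K"
      using short_awalk_of_diameter_less[of K i j] assms(2,6) i j by auto
    then have "proots (?c (B\<^sub>D j)) \<subseteq># agent_roots G B\<^sub>D K i"
      by (intro agent_roots_upper) auto
    then show ?thesis
      using nz[OF j] unfolding agent_denominator_def
      by (subst dvd_prod_linear_factors_iff) (auto simp: map_poly_eq_0_iff)
  qed
  then have ge: "?c L dvd agent_denominator G B\<^sub>D K i"
    unfolding L_def map_poly_of_real_Lcm_dvd_iff by auto
  \<comment> \<open>Mutual divisibility gives equality only up to a unit; both sides being monic
    removes it.\<close>
  have "lead_coeff (agent_denominator G B\<^sub>D K i) = 1"
    unfolding agent_denominator_def
    by (rule lead_coeff_prod_linear_factors)
  moreover have "lead_coeff (?c L) = 1"
    using L by (simp add: coeff_map_poly degree_map_poly)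
  ultimately show "agent_denominator G B\<^sub>D K i = ?c (LCM j\<in>{1..N}. B\<^sub>D j)"
    using le ge normalize_monic unfolding L_def by (metis associated_eqI)
qed

end
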